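(* Let $\{x^t\}_{t\ge 0}$ be the iterates of the multiplicative gradient (MG) method started from some $x^0\in\Delta_n$ with $x^0>0$ (entrywise), let $\bar x^t:=\frac{1}{t+1}\sum_{k=0}^t x^k$, and let $x^0_{\min}:=\min_{i\in[n]} x^0_i$. Then for all $t\ge 0$, $$f^* - f(x^t) \le \frac{-\ln(x^0_{\min})}{t+1}\quad\text{and}\quad f^* - f(\bar x^t) \le \frac{-\ln(x^0_{\min})}{t+1}.$$ Consequently, if $x^0=(1/n)e$, where $e=(1,\dots,1)^\top\in\mathbb{R}^n$, then for all $t\ge 0$, $$f^* - f(x^t) \le \frac{\ln(n)}{t+1}\quad\text{and}\quad f^* - f(\bar x^t) \le \frac{\ln(n)}{t+1}.$$
   Context: Let $m,n\ge 1$, $[n]=\{1,\dots,n\}$, and $\Delta_n=\{x\in\mathbb{R}^n: x\ge 0,\ \sum_{i=1}^n x_i=1\}$. Let $p_1,\dots,p_m>0$ with $\sum_{j=1}^m p_j=1$, and let $a_1,\dots,a_m\in\mathbb{R}^n$ be entrywise nonnegative and nonzero; $a_{ji}$ is the $i$-th entry of $a_j$. Let $f(x)=\sum_{j=1}^m p_j\ln(a_j^\top x)$ (with $\ln 0=-\infty$) and $f^*=\max_{x\in\Delta_n} f(x)$. MG method: given $x^0\in\Delta_n$ with all entries positive, for $t\ge 0$ set $x_i^{t+1}=x_i^t\,\nabla_i f(x^t)$ for all $i\in[n]$, where $\nabla_i f(x)=\sum_{j=1}^m p_j\frac{a_{ji}}{a_j^\top x}$. (All iterates lie in $\Delta_n$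 and satisfy $a_j^\top x^t>0$ for all $j$, so the method is well defined.) *)

theory Defs
  imports "HOL-Analysis.Analysis"
begin

definition prob_simplex :: "(real ^ 'n) set" where
  "prob_simplex = {x. (\<forall>i. 0 \<le> x $ i) \<and> (\<Sum>i\<in>UNIV. x $ i) = 1}"

text \<open>The library's real logarithm satisfies \<open>ln 0 = 0\<close>; here \<open>ln 0 = -\<infinity>\<close> is needed. The
  value at negative arguments is irrelevant: \<open>a\<^sub>j \<bullet> x \<ge> 0\<close> on the simplex.\<close>

definition ln_ext :: "real \<Rightarrow> ereal" where
  "ln_ext y = (if y > 0 then ereal (ln y) else -\<infinity>)"

definition objective :: "('m::finite \<Rightarrow> real) \<Rightarrow> ('m \<Rightarrow> real ^ 'n) \<Rightarrow> real ^ 'n \<Rightarrow> ereal" where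
  "objective p a x = (\<Sum>j\<in>UNIV. ereal (p j) * ln_ext (a j \<bullet> x))"

text \<open>The supremum below is a maximum, by \<open>opt_value_attained\<close>.\<close>

definition opt_value :: "('m::finite \<Rightarrow> real) \<Rightarrow> ('m \<Rightarrow> real ^ 'n) \<Rightarrow> ereal" where
  "opt_value p a = (SUP x\<in>prob_simplex. objective p a x)"

text \<open>The gradient of the objective where all \<open>a\<^sub>j \<bullet> x\<close> are positive,
  see \<open>objective_has_gradient\<close>.\<close>

definition obj_grad :: "('m::finite \<Rightarrow> real) \<Rightarrow> ('m \<Rightarrow> real ^ 'n) \<Rightarrow> real ^ 'n \<Rightarrow> real ^ 'n" where
  "obj_grad p a x = (\<chi> i. \<Sum>j\<in>UNIV. p j * (a j $ i / (a j \<bullet> x)))"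

primrec mg_iterate ::
  "('m::finite \<Rightarrow> real) \<Rightarrow> ('m \<Rightarrow> real ^ 'n) \<Rightarrow> real ^ 'n \<Rightarrow> nat \<Rightarrow> real ^ 'n" where
  "mg_iterate p a x0 0 = x0"
| "mg_iterate p a x0 (Suc t) =
     (\<chi> i. mg_iterate p a x0 t $ i * obj_grad p a (mg_iterate p a x0 t) $ i)"

definition mg_average ::
  "('m::finite \<Rightarrow> real) \<Rightarrow> ('m \<Rightarrow> real ^ 'n) \<Rightarrow> real ^ 'n \<Rightarrow> nat \<Rightarrow> real ^ 'n" where
  "mg_average p a x0 t = (1 / real (t + 1)) *\<^sub>R (\<Sum>k=0..t. mg_iterate p a x0 k)"

lemma objective_finite:
  assumes "\<And>j. a j \<bullet> x > 0"
  shows "objective p a x = ereal (\<Sum>j\<in>UNIV. p j * ln (a j \<bullet> x))"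
  using assms by (simp add: objective_def ln_ext_def)

lemma objective_MInfty:
  assumes p: "\<And>j. p j > 0" and j: "a j \<bullet> x \<le> 0"
  shows "objective p a x = -\<infinity>"
proof -
  have "(\<Sum>j\<in>UNIV - {j}. ereal (p j) * ln_ext (a j \<bullet> x)) \<noteq> \<infinity>"
    using p by (auto simp: sum_Pinfty ln_ext_def dest: less_asym)
  moreover have "ereal (p j) * ln_ext (a j \<bullet> x) = -\<infinity>"
    using p[of j] j by (simp add: ln_ext_def)
  moreover have "objective p a x =
      ereal (p j) * ln_ext (a j \<bullet> x) + (\<Sum>j\<in>UNIV - {j}. ereal (p j) * ln_ext (a j \<bullet> x))"
    unfolding objective_def by (rule sum.remove) simp_all
  ultimately show ?thesis
    by (simp only: ereal_plus_eq_MInfty) simp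
qed

lemma objective_has_gradient:
  assumes "\<And>j. a j \<bullet> x > 0"
  shows "((\<lambda>y. real_of_ereal (objective p a y)) has_derivative (\<lambda>h. obj_grad p a x \<bullet> h)) (at x)"
proof -
  define S where "S = (\<Inter>j. {y. a j \<bullet> y > 0})"
  have S: "open S" "x \<in> S"
    unfolding S_def using assms by (auto intro!: open_INT open_Collect_less continuous_intros)
  have eq: "obj_grad p a x \<bullet> h = (\<Sum>j\<in>UNIV. p j * ((a j \<bullet> h) / (a j \<bullet> x)))" for h
    unfolding obj_grad_def inner_vec_def
    by (simp add: sum_distrib_right sum_distrib_left sum_divide_distrib mult_ac)
       (rule sum.swap)
  have "((\<lambda>y. \<Sum>j\<in>UNIV. p j * ln (a j \<bullet> y)) has_derivative (\<lambda>h. obj_grad p a x \<bullet> h)) (at x)"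
    unfolding eq using assms
    by (auto intro!: derivative_eq_intros simp: less_imp_neq[symmetric] divide_inverse mult_ac)
  then show ?thesis
    by (rule has_derivative_transform_within_open[OF _ S]) (simp add: S_def objective_finite)
qed

lemma compact_prob_simplex: "compact (prob_simplex :: (real ^ 'n) set)"
proof -
  have "closed (prob_simplex :: (real ^ 'n) set)"
    unfolding prob_simplex_def
    by (intro closed_Collect_conj closed_Collect_all closed_Collect_le closed_Collect_eq
        continuous_intros)
  moreover have "norm x \<le> 1" if "x \<in> prob_simplex" for x :: "real ^ 'n"
    using that norm_le_l1_cart[of x] by (simp add: prob_simplex_def)
  ultimately show ?thesis
    by (auto simp: compact_eq_bounded_closed bounded_iff)
qed

lemma opt_value_attained:
  fixes p :: "'m::finite \<Rightarrow> real" and a :: "'m \<Rightarrow> real ^ 'n"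
  assumes p: "\<And>j. p j > 0" and a: "\<And>j i. a j $ i \<ge> 0"
  shows "\<exists>x\<in>prob_simplex. objective p a x = opt_value p a"
proof -
  define g where "g x = (\<Prod>j\<in>UNIV. (a j \<bullet> x) powr p j)" for x
  have nn: "a j \<bullet> x \<ge> 0" if "x \<in> prob_simplex" for x j
    using that a by (auto simp: prob_simplex_def inner_vec_def intro!: sum_nonneg)
  have fg: "objective p a x = ln_ext (g x)" if x: "x \<in> prob_simplex" for x
  proof (cases "\<forall>j. a j \<bullet> x > 0")
    case True
    then have "a j \<bullet> x \<noteq> 0" for j
      by (metis less_irrefl)
    with True show ?thesis
      by (simp add: objective_finite ln_ext_def g_def prod_pos ln_prod ln_powr)
  next
    case False
    then obtain j where j: "a j \<bullet> x \<le> 0"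
      by (auto simp: not_less)
    then have "a j \<bullet> x = 0"
      using nn[OF x, of j] by simp
    then have "g x = 0"
      by (auto simp: g_def intro!: exI[of _ j])
    with objective_MInfty[of p a j x] p j show ?thesis
      by (simp add: ln_ext_def)
  qed
  have "(\<chi> i. 1 / real CARD('n)) \<in> (prob_simplex :: (real ^ 'n) set)"
    by (simp add: prob_simplex_def)
  moreover have "continuous_on prob_simplex g"
    unfolding g_def using nn p
    by (intro continuous_on_prod continuous_on_powr' continuous_intros) auto
  ultimately obtain x where x: "x \<in> prob_simplex" "\<And>y. y \<in> prob_simplex \<Longrightarrow> g y \<le> g x"
    using continuous_attains_sup[OF compact_prob_simplex, of g] by blast
  have mono: "ln_ext u \<le> ln_ext v" if "u \<le> v" for u v
    using that by (auto simp: ln_ext_def)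
  have "opt_value p a = objective p a x"
    unfolding opt_value_def using x
    by (intro antisym SUP_least SUP_upper) (auto simp: fg mono)
  with x(1) show ?thesis
    by auto
qed

end

theory Submission
  imports Defs
begin

text \<open>
  Write \<open>T x\<close> for the vector with entries \<open>x\<^sub>i \<nabla>\<^sub>i f(x)\<close>. Jensen's inequality with weights
  \<open>a\<^sub>j\<^sub>i x\<^sub>i / (a\<^sub>j \<bullet> x)\<close> gives \<open>f(T x) - f(x) \<ge> KL(T x, x)\<close>. Hence \<open>f\<close> increases along the iterates,
  and a maximizer \<open>y\<close> is a fixed point of \<open>T\<close>, which is the only optimality condition needed.
  It says that for \<open>y\<^sub>i > 0\<close> the numbers \<open>p\<^sub>j a\<^sub>j\<^sub>i / (a\<^sub>j \<bullet> y)\<close> sum to one over \<open>j\<close>, and Jensen's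
  inequality with these weights gives
  \<open>f(y) - f(x) \<le> \<Sum>\<^sub>i y\<^sub>i ln (\<nabla>\<^sub>i f(x)) = KL(y, x) - KL(y, T x)\<close>.
  This telescopes along the iterates, and \<open>KL(y, x\<^sup>0) \<le> - ln x\<^sup>0\<^sub>m\<^sub>i\<^sub>n\<close>. The last iterate is
  handled by monotonicity and the average by concavity of \<open>f\<close>.
\<close>

section \<open>Scalar inequalities for the logarithm\<close>

lemma ln_jensen:
  fixes w y :: "'b \<Rightarrow> real"
  assumes I: "finite I" and w: "\<And>i. i \<in> I \<Longrightarrow> 0 \<le> w i" and w1: "sum w I = 1"
    and y: "\<And>i. i \<in> I \<Longrightarrow> 0 < w i \<Longrightarrow> 0 < y i"
  shows "(\<Sum>i\<in>I. w i * ln (y i)) \<le> ln (\<Sum>i\<in>I. w i * y i)"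
proof -
  define S where "S = (\<Sum>i\<in>I. w i * y i)"
  have nn: "0 \<le> w i * y i" if "i \<in> I" for i
    using w[OF that] y[OF that] by (cases "w i = 0") auto
  have "\<not> (\<forall>k\<in>I. w k \<le> 0)"
    using sum_nonpos[of I w] w1 by auto
  then obtain k where k: "k \<in> I" "0 < w k"
    by (auto simp: not_le)
  have S: "0 < S"
    unfolding S_def using k y nn by (intro sum_pos2[OF I k(1)]) auto
  \<comment> \<open>The tangent of \<open>ln\<close> at the weighted mean \<open>S\<close> lies
    above \<open>ln\<close>. In the sum over \<open>I\<close> its linear terms cancel, as both
    \<open>w i * y i / S\<close> and \<open>w i\<close> sum to one.\<close>
  have "w i * ln (y i) \<le> w i * ln S + (w i * y i / S - w i)" if i: "i \<in> I" for i
  proof (cases "w i = 0")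
    case False
    then have wi: "0 < w i" "0 < y i"
      using w[OF i] y[OF i] by auto
    have "ln (y i) - ln S \<le> y i / S - 1"
      using ln_le_minus_one[of "y i / S"] wi S by (simp add: ln_div)
    then have "w i * (ln (y i) - ln S) \<le> w i * (y i / S - 1)"
      using wi by (intro mult_left_mono) auto
    then show ?thesis
      by (simp add: algebra_simps)
  qed simp
  then have "(\<Sum>i\<in>I. w i * ln (y i)) \<le> (\<Sum>i\<in>I. w i * ln S + (w i * y i / S - w i))"
    by (rule sum_mono)
  also have "\<dots> = ln S"
    using S w1
    by (simp add: sum.distrib sum_subtractf flip: sum_distrib_right sum_divide_distrib S_def)
  finally show ?thesis
    by (simp add: S_def)
qed

text \<open>This is \<open>ln v \<le> v - 1\<close> at \<open>v = 1 / u\<close>, multiplied by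
  \<open>u\<close>. At \<open>u = G x i\<close> it yields the ascent of \<open>F\<close>; its
  equality case, proved next, yields the fixed-point property.\<close>

lemma mult_ln_ge_minus_one:
  assumes "0 \<le> (u::real)"
  shows "u - 1 \<le> u * ln u"
proof (cases "u = 0")
  case False
  with assms have "u > 0" by simp
  then have "- ln u \<le> 1 / u - 1"
    using ln_le_minus_one[of "1 / u"] by (simp add: ln_div)
  then have "u * (- ln u) \<le> u * (1 / u - 1)"
    using assms by (rule mult_left_mono)
  with \<open>u > 0\<close> show ?thesis
    by (simp add: algebra_simps)
qed simp

lemma mult_ln_eq_minus_one:
  assumes "0 \<le> (u::real)" "u * ln u = u - 1"
  shows "u = 1"
proof -
  have u: "u > 0"
    using assms by (cases "u = 0") auto
  then have "ln (1 / u) = 1 / u - 1"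
    using assms(2) by (simp add: ln_div field_simps)
  then have "1 / u = 1"
    using u by (intro ln_eq_minus_one) auto
  then show ?thesis
    using u by simp
qed

lemma prob_simplex_nonneg: "x \<in> prob_simplex \<Longrightarrow> 0 \<le> x $ i"
  and prob_simplex_sum: "x \<in> prob_simplex \<Longrightarrow> (\<Sum>i\<in>UNIV. x $ i) = 1"
  by (auto simp: prob_simplex_def)

lemma prob_simplex_le_one: "x \<in> prob_simplex \<Longrightarrow> x $ i \<le> 1"
  using member_le_sum[of i UNIV "($) x"] by (simp add: prob_simplex_def)

section \<open>The multiplicative update and its ascent property\<close>

locale mg_problem =
  fixes p :: "'m::finite \<Rightarrow> real" and a :: "'m \<Rightarrow> real ^ 'n"
  assumes p_pos: "\<And>j. p j > 0"
    and p_sum: "(\<Sum>j\<in>UNIV. p j) = 1"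
    and a_nonneg: "\<And>j i. a j $ i \<ge> 0"
    and a_nonzero: "\<And>j. a j \<noteq> 0"
begin

definition F :: "real ^ 'n \<Rightarrow> real" where
  "F x = (\<Sum>j\<in>UNIV. p j * ln (a j \<bullet> x))"

abbreviation G :: "real ^ 'n \<Rightarrow> 'n \<Rightarrow> real" where
  "G x i \<equiv> obj_grad p a x $ i"

definition T :: "real ^ 'n \<Rightarrow> real ^ 'n" where
  "T x = (\<chi> i. x $ i * G x i)"

text \<open>The part of the simplex on which the objective is finite. Elsewhere on the simplex it is
  \<open>-\<infinity>\<close>, while \<open>F\<close> stays real because
  \<open>ln 0 = 0\<close>.\<close>

definition dom :: "(real ^ 'n) set" where
  "dom = {x \<in> prob_simplex. \<forall>j. 0 < a j \<bullet> x}"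

lemma dom_simplex: "x \<in> dom \<Longrightarrow> x \<in> prob_simplex"
  and dom_pos: "x \<in> dom \<Longrightarrow> 0 < a j \<bullet> x"
  by (auto simp: dom_def)

lemma objective_dom: "x \<in> dom \<Longrightarrow> objective p a x = ereal (F x)"
  by (simp add: objective_finite F_def dom_pos)

lemma ex_entry_pos: "\<exists>i. 0 < a j $ i"
  using a_nonzero[of j] a_nonneg[of j] by (metis less_eq_real_def vec_eq_iff zero_index)

lemma inner_posI:
  assumes "\<And>i. 0 \<le> x $ i" "0 < a j $ i" "0 < x $ i"
  shows "0 < a j \<bullet> x"
  unfolding inner_vec_def using assms a_nonneg by (intro sum_pos2[of _ i]) auto

lemma grad_nonneg: "x \<in> dom \<Longrightarrow> 0 \<le> G x i"
  by (auto simp: obj_grad_def intro!: sum_nonneg mult_nonneg_nonneg divide_nonneg_pos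
      less_imp_le[OF p_pos] a_nonneg dom_pos)

lemma grad_pos:
  assumes x: "x \<in> dom" and "0 < a j $ i"
  shows "0 < G x i"
proof -
  have "0 < p j * (a j $ i / (a j \<bullet> x))"
    using assms p_pos dom_pos[OF x] by simp
  moreover have "0 \<le> p j * (a j $ i / (a j \<bullet> x))" for j
    using less_imp_le[OF p_pos] a_nonneg less_imp_le[OF dom_pos[OF x]] by simp
  ultimately show ?thesis
    unfolding obj_grad_def by (simp, intro sum_pos2[of _ j]) auto
qed

text \<open>Exchanging the sums turns a sum weighted by \<open>T x\<close> into a
  \<open>p\<close>-average of sums with the Jensen weights. The choice \<open>c = 1\<close> gives
  the mass of \<open>T x\<close>, and \<open>c = ln (G x i)\<close> the ascent.\<close>

lemma sum_mult_grad:
  "(\<Sum>i\<in>UNIV. x $ i * G x i * c i) = (\<Sum>j\<in>UNIV. p j * (\<Sum>i\<in>UNIV. a j $ i * x $ i / (a j \<bullet> x) * c i))"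
  by (simp add: obj_grad_def sum_distrib_left sum_distrib_right mult_ac)
    (rule sum.swap)

lemma sum_weights: "x \<in> dom \<Longrightarrow> (\<Sum>i\<in>UNIV. a j $ i * x $ i / (a j \<bullet> x)) = 1"
  using dom_pos[of x j] by (simp add: inner_vec_def flip: sum_divide_distrib)

lemma T_dom:
  assumes x: "x \<in> dom"
  shows "T x \<in> dom"
proof -
  note nn = prob_simplex_nonneg[OF dom_simplex[OF x]]
  have T_nn: "0 \<le> T x $ i" for i
    using nn grad_nonneg[OF x] by (simp add: T_def)
  have "(\<Sum>i\<in>UNIV. T x $ i) = 1"
    using sum_mult_grad[of x "\<lambda>_. 1"] by (simp add: T_def sum_weights[OF x] p_sum)
  moreover have "0 < a j \<bullet> T x" for j
  proof -
    \<comment> \<open>A coordinate that contributes to \<open>a j \<bullet> x\<close> stays positive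
      under \<open>T\<close>, so it still contributes afterwards.\<close>
    have "(\<Sum>i\<in>UNIV. a j $ i * x $ i) \<noteq> 0"
      using dom_pos[OF x, of j] by (simp add: inner_vec_def)
    then obtain i where "a j $ i * x $ i \<noteq> 0"
      by (rule sum.not_neutral_contains_not_neutral)
    then have "0 < a j $ i" "0 < x $ i"
      using a_nonneg[of j i] nn[of i] by auto
    then show ?thesis
      using grad_pos[OF x] by (intro inner_posI[OF T_nn]) (auto simp: T_def)
  qed
  ultimately show ?thesis
    using T_nn by (simp add: dom_def prob_simplex_def)
qed

text \<open>Since \<open>T x $ i / x $ i = G x i\<close>, the left side is the divergence KL(T x,
  x). Writing the ratio as a gradient entry avoids division by zero entries of
  \<open>x\<close>.\<close>

lemma T_ascent:
  assumes x: "x \<in> dom"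
  shows "(\<Sum>i\<in>UNIV. T x $ i * ln (G x i)) \<le> F (T x) - F x"
proof -
  note nn = prob_simplex_nonneg[OF dom_simplex[OF x]]
  have "(\<Sum>i\<in>UNIV. a j $ i * x $ i / (a j \<bullet> x) * ln (G x i)) \<le> ln (a j \<bullet> T x) - ln (a j \<bullet> x)" for j
  proof -
    have "(\<Sum>i\<in>UNIV. a j $ i * x $ i / (a j \<bullet> x) * ln (G x i))
        \<le> ln (\<Sum>i\<in>UNIV. a j $ i * x $ i / (a j \<bullet> x) * G x i)"
    proof (rule ln_jensen)
      \<comment> \<open>A gradient entry may vanish, but not where its weight is positive.\<close>
      fix i assume "0 < a j $ i * x $ i / (a j \<bullet> x)"
      then have "a j $ i \<noteq> 0" by auto
      then show "0 < G x i"
        using a_nonneg[of j i] grad_pos[OF x, of j i] by simp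
    qed (use nn a_nonneg dom_pos[OF x, of j] in \<open>auto simp: sum_weights[OF x]\<close>)
    \<comment> \<open>The weighted mean of the gradient is the factor by which
      \<open>a j \<bullet> x\<close> changes in one update.\<close>
    also have "(\<Sum>i\<in>UNIV. a j $ i * x $ i / (a j \<bullet> x) * G x i) = a j \<bullet> T x / (a j \<bullet> x)"
      unfolding inner_vec_def[of _ "T x"] by (simp add: T_def sum_divide_distrib mult_ac)
    finally show ?thesis
      using dom_pos[OF x, of j] dom_pos[OF T_dom[OF x], of j] by (simp add: ln_div)
  qed
  then have "(\<Sum>j\<in>UNIV. p j * (\<Sum>i\<in>UNIV. a j $ i * x $ i / (a j \<bullet> x) * ln (G x i)))
      \<le> (\<Sum>j\<in>UNIV. p j * (ln (a j \<bullet> T x) - ln (a j \<bullet> x)))"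
    by (intro sum_mono mult_left_mono less_imp_le[OF p_pos])
  then show ?thesis
    by (simp add: T_def F_def sum_mult_grad right_diff_distrib sum_subtractf)
qed

text \<open>Both \<open>x\<close> and \<open>T x\<close> have mass one. Hence the term
  \<open>u - 1\<close> of the scalar bound averages to zero.\<close>

lemma sum_mult_grad_minus_one: "x \<in> dom \<Longrightarrow> (\<Sum>i\<in>UNIV. x $ i * (G x i - 1)) = 0"
  using prob_simplex_sum[OF dom_simplex[OF T_dom, of x]] prob_simplex_sum[OF dom_simplex, of x]
  by (simp add: T_def right_diff_distrib sum_subtractf)

lemma F_mono:
  assumes x: "x \<in> dom"
  shows "F x \<le> F (T x)"
proof -
  have "(\<Sum>i\<in>UNIV. x $ i * (G x i - 1)) \<le> (\<Sum>i\<in>UNIV. x $ i * (G x i * ln (G x i)))"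
    by (intro sum_mono mult_left_mono mult_ln_ge_minus_one grad_nonneg[OF x]
        prob_simplex_nonneg dom_simplex[OF x])
  then show ?thesis
    using T_ascent[OF x] by (simp add: sum_mult_grad_minus_one[OF x] T_def mult_ac)
qed

text \<open>The terms \<open>?r\<close> are nonnegative, and their sum is the divergence of
  \<open>T_ascent\<close>, which \<open>max\<close> forces to be at most zero. So each term
  vanishes, and the equality case of the scalar bound applies.\<close>

lemma maximizer_fixed:
  assumes x: "x \<in> dom" and max: "F (T x) \<le> F x" and i: "x $ i \<noteq> 0"
  shows "G x i = 1"
proof -
  let ?r = "\<lambda>i. x $ i * (G x i * ln (G x i) - (G x i - 1))"
  have nn: "0 \<le> ?r i" for i
    using mult_ln_ge_minus_one[OF grad_nonneg[OF x]] prob_simplex_nonneg[OF dom_simplex[OF x]]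
    by (intro mult_nonneg_nonneg) auto
  have "(\<Sum>i\<in>UNIV. ?r i) = (\<Sum>i\<in>UNIV. T x $ i * ln (G x i)) - (\<Sum>i\<in>UNIV. x $ i * (G x i - 1))"
    by (simp add: T_def mult_ac right_diff_distrib flip: sum_subtractf)
  then have "(\<Sum>i\<in>UNIV. ?r i) \<le> 0"
    using T_ascent[OF x] max by (simp add: sum_mult_grad_minus_one[OF x])
  then have "(\<Sum>i\<in>UNIV. ?r i) = 0"
    using nn by (meson order_antisym sum_nonneg)
  then have "?r i = 0"
    using nn by (simp add: sum_nonneg_eq_0_iff)
  then show ?thesis
    using i by (intro mult_ln_eq_minus_one grad_nonneg[OF x]) auto
qed

section \<open>Optimality gap, concavity and existence of a maximizer\<close>

lemma gap_le:
  assumes y: "y \<in> dom" and fixed: "\<And>i. y $ i \<noteq> 0 \<Longrightarrow> G y i = 1" and x: "x \<in> dom"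
  shows "F y - F x \<le> (\<Sum>i\<in>UNIV. y $ i * ln (G x i))"
proof -
  define r where "r j = (a j \<bullet> y) / (a j \<bullet> x)" for j
  define w where "w i j = p j * (a j $ i / (a j \<bullet> y))" for i j
  have r: "0 < r j" "ln (r j) = ln (a j \<bullet> y) - ln (a j \<bullet> x)" for j
    using dom_pos[OF x, of j] dom_pos[OF y, of j] by (simp_all add: r_def ln_div)
  \<comment> \<open>For each \<open>j\<close> a factor one is inserted as a sum of Jensen weights at
    \<open>y\<close>; exchanging the sums then exposes the weights \<open>w i\<close>.\<close>
  have "F y - F x = (\<Sum>j\<in>UNIV. p j * (\<Sum>i\<in>UNIV. a j $ i * y $ i / (a j \<bullet> y)) * ln (r j))"
    by (simp add: F_def sum_weights[OF y] r(2) right_diff_distrib sum_subtractf)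
  also have "\<dots> = (\<Sum>i\<in>UNIV. y $ i * (\<Sum>j\<in>UNIV. w i j * ln (r j)))"
    by (simp add: w_def sum_distrib_left sum_distrib_right mult_ac) (rule sum.swap)
  also have "\<dots> \<le> (\<Sum>i\<in>UNIV. y $ i * ln (G x i))"
  proof (rule sum_mono)
    fix i
    show "y $ i * (\<Sum>j\<in>UNIV. w i j * ln (r j)) \<le> y $ i * ln (G x i)"
    proof (cases "y $ i = 0")
      case False
      have "(\<Sum>j\<in>UNIV. w i j * ln (r j)) \<le> ln (\<Sum>j\<in>UNIV. w i j * r j)"
        using fixed[OF False] r(1) less_imp_le[OF p_pos] a_nonneg less_imp_le[OF dom_pos[OF y]]
        by (intro ln_jensen) (auto simp: w_def obj_grad_def)
      \<comment> \<open>The factor \<open>a j \<bullet> y\<close> cancels between weight and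
        ratio.\<close>
      also have "(\<Sum>j\<in>UNIV. w i j * r j) = G x i"
        using less_imp_neq[OF dom_pos[OF y]]
        by (auto simp: w_def r_def obj_grad_def intro!: sum.cong)
      finally show ?thesis
        using prob_simplex_nonneg[OF dom_simplex[OF y]] by (rule mult_left_mono)
    qed simp
  qed
  finally show ?thesis .
qed

lemma F_mean:
  assumes K: "finite K" "K \<noteq> {}" and x: "\<And>k. k \<in> K \<Longrightarrow> x k \<in> dom"
  defines "v \<equiv> (1 / real (card K)) *\<^sub>R (\<Sum>k\<in>K. x k)"
  shows "v \<in> dom" and "(\<Sum>k\<in>K. F (x k)) / real (card K) \<le> F v"
proof -
  define c where "c = 1 / real (card K)"
  have c: "0 < c" "real (card K) * c = 1"
    using K by (simp_all add: c_def card_gt_0_iff)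
  have v: "a j \<bullet> v = (\<Sum>k\<in>K. c * (a j \<bullet> x k))" for j
    by (simp add: v_def c_def inner_sum_right sum_distrib_left sum_divide_distrib)
  have pos: "0 < a j \<bullet> v" for j
    unfolding v using K c dom_pos[OF x] by (intro sum_pos) auto
  have "(\<Sum>i\<in>UNIV. v $ i) = c * (\<Sum>k\<in>K. \<Sum>i\<in>UNIV. x k $ i)"
    by (simp add: v_def c_def sum_distrib_left[symmetric] sum_divide_distrib[symmetric])
      (subst sum.swap, simp)
  also have "\<dots> = 1"
    using c prob_simplex_sum[OF dom_simplex[OF x]] by (simp add: mult.commute)
  finally show "v \<in> dom"
    using pos prob_simplex_nonneg[OF dom_simplex[OF x]]
    by (auto simp: dom_def prob_simplex_def v_def intro!: sum_nonneg divide_nonneg_nonneg)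
  have "(\<Sum>k\<in>K. c * ln (a j \<bullet> x k)) \<le> ln (a j \<bullet> v)" for j
    unfolding v using K c dom_pos[OF x] by (intro ln_jensen) auto
  then have "(\<Sum>j\<in>UNIV. p j * (\<Sum>k\<in>K. c * ln (a j \<bullet> x k))) \<le> F v"
    unfolding F_def by (intro sum_mono mult_left_mono less_imp_le[OF p_pos])
  also have "(\<Sum>j\<in>UNIV. p j * (\<Sum>k\<in>K. c * ln (a j \<bullet> x k))) = c * (\<Sum>k\<in>K. F (x k))"
    by (simp add: F_def sum_distrib_left mult_ac) (rule sum.swap)
  finally show "(\<Sum>k\<in>K. F (x k)) / real (card K) \<le> F v"
    by (simp add: c_def)
qed

lemma mg_iterate_Suc: "mg_iterate p a x0 (Suc t) = T (mg_iterate p a x0 t)"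
  by (simp add: T_def)

lemma pos_dom:
  assumes "x \<in> prob_simplex" "\<And>i. 0 < x $ i"
  shows "x \<in> dom"
proof -
  have "0 < a j \<bullet> x" for j
    using ex_entry_pos[of j] assms(2) by (auto intro!: inner_posI less_imp_le)
  with assms(1) show ?thesis
    by (simp add: dom_def)
qed

lemma ex_maximizer:
  obtains y where "y \<in> dom" "opt_value p a = ereal (F y)" "\<And>x. x \<in> dom \<Longrightarrow> F x \<le> F y"
proof -
  obtain y where y: "y \<in> prob_simplex" "objective p a y = opt_value p a"
    using opt_value_attained[of p a] p_pos a_nonneg by blast
  have le: "objective p a x \<le> objective p a y" if "x \<in> prob_simplex" for x
    using that by (auto simp: y(2) opt_value_def intro: SUP_upper)
  \<comment> \<open>The uniform point has a finite objective value, so the optimum is finite and the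
    maximizer must lie in \<open>dom\<close>.\<close>
  define u :: "real ^ 'n" where "u = (\<chi> i. 1 / real CARD('n))"
  have u: "u \<in> dom"
    by (intro pos_dom) (auto simp: u_def prob_simplex_def)
  have "objective p a y \<noteq> -\<infinity>"
    using le[OF dom_simplex[OF u]] objective_dom[OF u] by auto
  then have "y \<in> dom"
    using y(1) objective_MInfty[of p a _ y] p_pos by (auto simp: dom_def not_le[symmetric])
  moreover from this have "F x \<le> F y" if "x \<in> dom" for x
    using le[OF dom_simplex[OF that]] that by (simp add: objective_dom)
  ultimately show ?thesis
    using that y(2) objective_dom by metis
qed

section \<open>Convergence rate along the iterates\<close>

context
  fixes x0 :: "real ^ 'n"
  assumes x0: "x0 \<in> prob_simplex" "\<And>i. x0 $ i > 0"
begin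

abbreviation X :: "nat \<Rightarrow> real ^ 'n" where
  "X \<equiv> mg_iterate p a x0"

lemma X_dom: "X t \<in> dom"
  by (induction t) (simp_all only: mg_iterate_Suc T_dom mg_iterate.simps(1) pos_dom x0)

text \<open>Every step multiplies the entry by a positive gradient entry. A coordinate on which all
  \<open>a j\<close> vanish drops to zero after one step, whence the hypothesis.\<close>

lemma X_pos:
  assumes "0 < a j $ i"
  shows "0 < X t $ i"
  by (induction t) (auto simp: x0 grad_pos[OF X_dom assms])

lemma sum_gap_le:
  assumes y: "y \<in> dom" and fixed: "\<And>i. y $ i \<noteq> 0 \<Longrightarrow> G y i = 1"
  shows "(\<Sum>k=0..t. F y - F (X k)) \<le> - ln (MIN i. x0 $ i)"
proof -
  \<comment> \<open>The logarithm of the update rule. Where \<open>y $ i \<noteq> 0\<close>, the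
    gradient entry one at \<open>y\<close> forces some \<open>a j $ i\<close> to be positive, so
    both factors are positive.\<close>
  have ln_Suc: "y $ i * ln (X (Suc k) $ i) = y $ i * ln (X k $ i) + y $ i * ln (G (X k) i)" for k i
  proof (cases "y $ i = 0")
    case False
    then have "(\<Sum>j\<in>UNIV. p j * (a j $ i / (a j \<bullet> y))) \<noteq> 0"
      using fixed[OF False] by (simp add: obj_grad_def)
    then obtain j where "a j $ i \<noteq> 0"
      by (metis (no_types, lifting) div_0 mult_zero_right sum.neutral)
    then have "0 < a j $ i"
      using a_nonneg[of j i] by simp
    then show ?thesis
      using X_pos[of j i k] grad_pos[OF X_dom, of j i k] by (simp add: ln_mult algebra_simps)
  qed simp
  have gap: "F y - F (X k) \<le> (\<Sum>i\<in>UNIV. y $ i * ln (G (X k) i))" for k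
    using y fixed X_dom by (rule gap_le)
  note y_nn = prob_simplex_nonneg[OF dom_simplex[OF y]]
  \<comment> \<open>The KL terms telescope; the entropy of \<open>y\<close> cancels and is left out.
    The \<open>t + 1\<close> gaps lead from \<open>X 0\<close> to \<open>X (Suc t)\<close>.\<close>
  have "(\<Sum>k=0..t. F y - F (X k))
      \<le> (\<Sum>i\<in>UNIV. y $ i * ln (X (Suc t) $ i)) - (\<Sum>i\<in>UNIV. y $ i * ln (x0 $ i))"
  proof (induction t)
    case 0
    show ?case
      using gap[of 0] by (simp only: ln_Suc sum.distrib) simp
  next
    case (Suc t)
    then show ?case
      using gap[of "Suc t"]
      by (simp only: ln_Suc[of _ "Suc t"] sum.distrib sum.atLeast0_atMost_Suc)
  qed
  moreover have "(\<Sum>i\<in>UNIV. y $ i * ln (X (Suc t) $ i)) \<le> 0"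
  proof (intro sum_nonpos mult_nonneg_nonpos y_nn)
    fix i
    have "0 \<le> X (Suc t) $ i" "X (Suc t) $ i \<le> 1"
      using prob_simplex_nonneg prob_simplex_le_one dom_simplex[OF X_dom] by blast+
    \<comment> \<open>A zero entry is harmless because \<open>ln 0 = 0\<close>.\<close>
    then show "ln (X (Suc t) $ i) \<le> 0"
      by (cases "X (Suc t) $ i = 0") (simp_all del: mg_iterate.simps)
  qed
  moreover have "(\<Sum>i\<in>UNIV. y $ i * ln (MIN i. x0 $ i)) \<le> (\<Sum>i\<in>UNIV. y $ i * ln (x0 $ i))"
    using x0(2) by (intro sum_mono mult_left_mono y_nn) (auto simp: Min_gr_iff)
  moreover have "(\<Sum>i\<in>UNIV. y $ i * ln (MIN i. x0 $ i)) = ln (MIN i. x0 $ i)"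
    using prob_simplex_sum[OF dom_simplex[OF y]] by (simp flip: sum_distrib_right)
  ultimately show ?thesis
    by linarith
qed

lemma mg_gap_bounds:
  "opt_value p a - objective p a (X t) \<le> ereal (- ln (MIN i. x0 $ i) / real (t + 1))"
  "opt_value p a - objective p a (mg_average p a x0 t)
    \<le> ereal (- ln (MIN i. x0 $ i) / real (t + 1))"
proof -
  obtain y where y: "y \<in> dom" "opt_value p a = ereal (F y)" "\<And>x. x \<in> dom \<Longrightarrow> F x \<le> F y"
    by (blast intro: ex_maximizer)
  have total: "(\<Sum>k=0..t. F y - F (X k)) \<le> - ln (MIN i. x0 $ i)"
    using maximizer_fixed[OF y(1) y(3)[OF T_dom[OF y(1)]]] by (rule sum_gap_le[OF y(1)])
  \<comment> \<open>It suffices to reach the mean of the values along the iterates: the last iterate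
    does so by monotonicity, the average by concavity.\<close>
  have bound: "opt_value p a - objective p a x \<le> ereal (- ln (MIN i. x0 $ i) / real (t + 1))"
    if x: "x \<in> dom" and le: "(\<Sum>k=0..t. F (X k)) / real (t + 1) \<le> F x" for x
  proof -
    have "(\<Sum>k=0..t. F (X k)) \<le> real (t + 1) * F x"
      using le by (simp add: divide_le_eq mult.commute)
    then have "real (t + 1) * (F y - F x) \<le> - ln (MIN i. x0 $ i)"
      using total by (simp add: sum_subtractf algebra_simps)
    then have "F y - F x \<le> - ln (MIN i. x0 $ i) / real (t + 1)"
      by (intro mult_imp_le_div_pos) (simp_all add: mult.commute)
    then show ?thesis
      using x y(2) by (simp add: objective_dom)
  qed
  have "incseq (\<lambda>k. F (X k))"
    by (intro incseq_SucI) (simp only: mg_iterate_Suc F_mono X_dom)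
  then have "(\<Sum>k=0..t. F (X k)) \<le> of_nat (card {0..t}) * F (X t)"
    by (intro sum_bounded_above) (auto dest: incseqD)
  then show "opt_value p a - objective p a (X t) \<le> ereal (- ln (MIN i. x0 $ i) / real (t + 1))"
    by (intro bound X_dom) (simp add: divide_le_eq mult.commute)
  show "opt_value p a - objective p a (mg_average p a x0 t)
      \<le> ereal (- ln (MIN i. x0 $ i) / real (t + 1))"
    using F_mean[of "{0..t}" X] X_dom by (intro bound) (simp_all add: mg_average_def)
qed

end

end

theorem corollary1:
  fixes p :: "'m::finite \<Rightarrow> real"
    and a :: "'m \<Rightarrow> real ^ 'n"
    and x0 :: "real ^ 'n"
  assumes p_pos: "\<And>j. p j > 0"
    and p_sum: "(\<Sum>j\<in>UNIV. p j) = 1"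
    and a_nonneg: "\<And>j i. a j $ i \<ge> 0"
    and a_nonzero: "\<And>j. a j \<noteq> 0"
    and x0_simplex: "x0 \<in> prob_simplex"
    and x0_pos: "\<And>i. x0 $ i > 0"
  shows "(\<forall>t. opt_value p a - objective p a (mg_iterate p a x0 t)
              \<le> ereal (- ln (MIN i. x0 $ i) / real (t + 1))
            \<and> opt_value p a - objective p a (mg_average p a x0 t)
              \<le> ereal (- ln (MIN i. x0 $ i) / real (t + 1)))
       \<and> (x0 = (1 / real CARD('n)) *\<^sub>R (\<chi> i. 1) \<longrightarrow>
          (\<forall>t. opt_value p a - objective p a (mg_iterate p a x0 t)
                \<le> ereal (ln (real CARD('n)) / real (t + 1))
             \<and> opt_value p a - objective p a (mg_average p a x0 t)
                \<le> ereal (ln (real CARD('n)) / real (t + 1))))"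
proof -
  interpret mg_problem p a
    by unfold_locales (fact assms)+
  have bounds: "opt_value p a - objective p a (mg_iterate p a x0 t)
        \<le> ereal (- ln (MIN i. x0 $ i) / real (t + 1))"
      "opt_value p a - objective p a (mg_average p a x0 t)
        \<le> ereal (- ln (MIN i. x0 $ i) / real (t + 1))" for t
    using mg_gap_bounds[OF x0_simplex x0_pos] by auto
  have "- ln (MIN i. x0 $ i) = ln (real CARD('n))"
    if "x0 = (1 / real CARD('n)) *\<^sub>R (\<chi> i. 1)"
  proof -
    \<comment> \<open>All entries coincide, so the minimum is that of a singleton.\<close>
    have "range (($) x0) = {1 / real CARD('n)}"
      using that by auto
    then show ?thesis
      by (simp add: ln_div)
  qed
  with bounds show ?thesis
    by metis
qed

end
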